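(* Let $d_1,d_2\in\mathbb{N}$. Then $\mathrm{UEB}(d_1,d_2)$ is the $C^*$-convex hull of the set of its $C^*$-extreme points.
   Context: $M_d$ is the algebra of complex $d\times d$ matrices; $\mathrm{Ad}_V(X)=V^*XV$. A positive semidefinite matrix $X\in M_k\otimes M_{d}$ is separable if $X=\sum_{i=1}^nA_i\otimes B_i$ with $A_i\in M_k$, $B_i\in M_d$ positive semidefinite. A completely positive map $\Phi:M_{d_1}\to M_{d_2}$ is entanglement breaking (an EB-map) if for every $k\ge1$ and every positive semidefinite $X\in M_k\otimes M_{d_1}$ the matrix $(\mathrm{id}_k\otimes\Phi)(X)$ is separable. $\mathrm{UEB}(d_1,d_2)$ is the set of all unital EB-maps $M_{d_1}\to M_{d_2}$. $\Phi\in\mathrm{UEB}(d_1,d_2)$ is a $C^*$-extreme point of $\mathrm{UEB}(d_1,d_2)$ if, whenever $\Phi=\sum_{i=1}^n\mathrm{Ad}_{T_i}\circ\Phi_i$ with $T_i\in M_{d_2}$ invertible, $\sum_{i=1}^nT_i^*T_i=I_{d_2}$ and $\Phi_i\in\mathrm{UEB}(d_1,d_2)$, then there exist unitaries $U_i\in M_{d_2}$ such that $\Phi_i=\mathrm{Ad}_{U_i}\circ\Phi$ for all $1\le i\le n$. The $C^*$-convex hull of a subset $\mathcal{S}\subseteq\mathrm{UEB}(d_1,d_2)$ is the set of all finite sums $\sum_{i=1}^n\mathrm{Ad}_{T_i}\circ\Phi_i$ with $\Phi_i\in\mathcal{S}$ and $T_i\in M_{d_2}$ (not necessarily invertible) such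 that $\sum_{i=1}^nT_i^*T_i=I_{d_2}$. *)

theory Defs
  imports "HOL-Analysis.Analysis"
begin

text \<open>
  The algebra \<open>M_d\<close> is the type \<open>complex^'d^'d\<close> with \<open>d = CARD('d)\<close>.  Since the amplification
  degree \<open>k\<close> is quantified inside the definition of an entanglement breaking map, it cannot be
  encoded as a type: a matrix in \<open>M_k\<close> is a function \<open>nat \<Rightarrow> nat \<Rightarrow> complex\<close> of which only the
  entries with indices below \<open>k\<close> matter, and a matrix in \<open>M_k \<otimes> M_d\<close> is a function on pairs of
  indices from \<open>{..<k} \<times> UNIV\<close>.
\<close>

type_synonym 'd cmat = "complex^'d^'d"
type_synonym 'd tmat = "nat \<times> 'd \<Rightarrow> nat \<times> 'd \<Rightarrow> complex"

definition adj :: "'d::finite cmat \<Rightarrow> 'd cmat" where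
  "adj A = map_matrix cnj (transpose A)"

definition unitary_mat :: "'d::finite cmat \<Rightarrow> bool" where
  "unitary_mat U \<longleftrightarrow> adj U ** U = mat 1 \<and> U ** adj U = mat 1"

definition Ad :: "'d::finite cmat \<Rightarrow> 'd cmat \<Rightarrow> 'd cmat" where
  "Ad V X = adj V ** X ** V"

definition cscale :: "complex \<Rightarrow> 'd::finite cmat \<Rightarrow> 'd cmat" where
  "cscale c X = map_matrix (\<lambda>z. c * z) X"

definition psd_on :: "'i set \<Rightarrow> ('i \<Rightarrow> 'i \<Rightarrow> complex) \<Rightarrow> bool" where
  "psd_on I X \<longleftrightarrow>
     (\<forall>v. (\<Sum>p\<in>I. \<Sum>q\<in>I. cnj (v p) * X p q * v q) \<in> \<real> \<and>
          0 \<le> Re (\<Sum>p\<in>I. \<Sum>q\<in>I. cnj (v p) * X p q * v q))"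

definition psd :: "'d::finite cmat \<Rightarrow> bool" where
  "psd B \<longleftrightarrow> psd_on UNIV (\<lambda>a b. B $ a $ b)"

definition psd_tensor :: "nat \<Rightarrow> 'd::finite tmat \<Rightarrow> bool" where
  "psd_tensor k X \<longleftrightarrow> psd_on ({..<k} \<times> UNIV) X"

definition kron :: "(nat \<Rightarrow> nat \<Rightarrow> complex) \<Rightarrow> 'd::finite cmat \<Rightarrow> 'd tmat" where
  "kron A B = (\<lambda>(i, a) (j, b). A i j * B $ a $ b)"

definition separable :: "nat \<Rightarrow> 'd::finite tmat \<Rightarrow> bool" where
  "separable k X \<longleftrightarrow> psd_tensor k X \<and>
     (\<exists>(n::nat) A B. (\<forall>l<n. psd_on {..<k} (A l) \<and> psd (B l)) \<and>
        (\<forall>p \<in> {..<k} \<times> UNIV. \<forall>q \<in> {..<k} \<times> UNIV. X p q = (\<Sum>l<n. kron (A l) (B l) p q)))"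

text \<open>
  The map \<open>id_k \<otimes> \<Phi>\<close> applies \<open>\<Phi>\<close> to every block \<open>(X (i, a) (j, b))\<^sub>a\<^sub>b\<close>; the formula does not
  depend on \<open>k\<close>.
\<close>

definition id_tensor :: "('a::finite cmat \<Rightarrow> 'b::finite cmat) \<Rightarrow> 'a tmat \<Rightarrow> 'b tmat" where
  "id_tensor \<Phi> X = (\<lambda>(i, a) (j, b). \<Phi> (\<chi> a' b'. X (i, a') (j, b')) $ a $ b)"

definition complex_linear :: "('a::finite cmat \<Rightarrow> 'b::finite cmat) \<Rightarrow> bool" where
  "complex_linear \<Phi> \<longleftrightarrow> Vector_Spaces.linear cscale cscale \<Phi>"

lemma vector_space_cscale: "vector_space (cscale :: complex \<Rightarrow> 'd::finite cmat \<Rightarrow> 'd cmat)"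
  by unfold_locales (simp_all add: cscale_def map_matrix_def vec_eq_iff algebra_simps)

lemma complex_linear_iff:
  "complex_linear \<Phi> \<longleftrightarrow>
     (\<forall>X Y. \<Phi> (X + Y) = \<Phi> X + \<Phi> Y) \<and> (\<forall>c X. \<Phi> (cscale c X) = cscale c (\<Phi> X))"
  unfolding complex_linear_def Vector_Spaces.linear_iff
  by (simp add: vector_space_cscale)

lemma id_tensor_kron:
  assumes "complex_linear \<Phi>"
  shows "id_tensor \<Phi> (kron A B) = kron A (\<Phi> B)"
proof -
  have "\<Phi> (cscale c B) = cscale c (\<Phi> B)" for c
    using assms by (simp add: complex_linear_iff)
  moreover have "(\<chi> a b. A i j * B $ a $ b) = cscale (A i j) B" for i j
    by (simp add: cscale_def map_matrix_def)
  ultimately show ?thesis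
    by (auto simp: id_tensor_def kron_def cscale_def map_matrix_def fun_eq_iff)
qed

definition completely_positive :: "('a::finite cmat \<Rightarrow> 'b::finite cmat) \<Rightarrow> bool" where
  "completely_positive \<Phi> \<longleftrightarrow> complex_linear \<Phi> \<and>
     (\<forall>k\<ge>1. \<forall>X. psd_tensor k X \<longrightarrow> psd_tensor k (id_tensor \<Phi> X))"

definition entanglement_breaking :: "('a::finite cmat \<Rightarrow> 'b::finite cmat) \<Rightarrow> bool" where
  "entanglement_breaking \<Phi> \<longleftrightarrow> completely_positive \<Phi> \<and>
     (\<forall>k\<ge>1. \<forall>X. psd_tensor k X \<longrightarrow> separable k (id_tensor \<Phi> X))"

definition UEB :: "('a::finite cmat \<Rightarrow> 'b::finite cmat) set" where
  "UEB = {\<Phi>. entanglement_breaking \<Phi> \<and> \<Phi> (mat 1) = mat 1}"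

definition cstar_extreme :: "('a::finite cmat \<Rightarrow> 'b::finite cmat) \<Rightarrow> bool" where
  "cstar_extreme \<Phi> \<longleftrightarrow> \<Phi> \<in> UEB \<and>
     (\<forall>(n::nat) T \<Psi>.
        (\<forall>i<n. invertible (T i) \<and> \<Psi> i \<in> UEB) \<and>
        (\<Sum>i<n. adj (T i) ** T i) = mat 1 \<and>
        \<Phi> = (\<lambda>X. \<Sum>i<n. Ad (T i) (\<Psi> i X)) \<longrightarrow>
        (\<exists>U. \<forall>i<n. unitary_mat (U i) \<and> \<Psi> i = Ad (U i) \<circ> \<Phi>))"

definition cstar_convex_hull ::
    "('a::finite cmat \<Rightarrow> 'b::finite cmat) set \<Rightarrow> ('a cmat \<Rightarrow> 'b cmat) set" where
  "cstar_convex_hull S =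
     {\<Phi>. \<exists>(n::nat) T \<Psi>.
        (\<forall>i<n. \<Psi> i \<in> S) \<and>
        (\<Sum>i<n. adj (T i) ** T i) = mat 1 \<and>
        \<Phi> = (\<lambda>X. \<Sum>i<n. Ad (T i) (\<Psi> i X))}"

end

theory Submission
  imports Defs "HOL-Library.Complex_Order"
begin

text \<open>
  The theorem reduces to an explicit description of entanglement breaking maps, the Holevo form
  \<open>\<Phi>(X) = \<Sum>\<^sub>l \<langle>u\<^sub>l, X u\<^sub>l\<rangle> b\<^sub>l b\<^sub>l\<^sup>*\<close>.
  Applied to the (unnormalised) maximally entangled state, \<open>id \<otimes> \<Phi>\<close> produces the Choi matrix of
  \<open>\<Phi>\<close>; its separability says \<open>\<Phi>(X) = \<Sum>\<^sub>l f\<^sub>l(X) B\<^sub>l\<close> with positive functionals \<open>f\<^sub>l\<close> and positive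
  semidefinite \<open>B\<^sub>l\<close>, and splitting both into rank-one pieces gives the Holevo form
  (\<open>holevo_of_entanglement_breaking\<close>).  Conversely every map in Holevo form is entanglement breaking.
  Since Holevo forms are closed under sums and under \<open>Ad T\<close>, the unital ones are closed under
  \<open>C\<^sup>*\<close>-convex combinations, which is one inclusion.

  For the other inclusion it suffices to have enough extreme points, and the pure states
  \<open>X \<mapsto> \<langle>u, X u\<rangle> 1\<close> with \<open>u\<close> a unit vector are enough: when each \<open>u\<^sub>l\<close> is normalised and the scalar is
  absorbed into \<open>b\<^sub>l\<close>, a Holevo form reads \<open>\<Sum>\<^sub>l T\<^sub>l\<^sup>* (\<langle>u\<^sub>l, X u\<^sub>l\<rangle> 1) T\<^sub>l\<close> with \<open>T\<^sub>l\<^sup>* T\<^sub>l = b\<^sub>l b\<^sub>l\<^sup>*\<close>.  The \<open>T\<^sub>l\<close> have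
  rank at most one, which is harmless because the coefficients in a \<open>C\<^sup>*\<close>-convex hull need not be
  invertible.

  A pure state is \<open>C\<^sup>*\<close>-extreme (\<open>cstar_extreme_pure_state\<close>) because it vanishes at the projection
  \<open>1 - u u\<^sup>*\<close>.  In a proper decomposition \<open>\<Sum>\<^sub>i T\<^sub>i\<^sup>* \<Psi>\<^sub>i(\<sqdot>) T\<^sub>i\<close> all summands are positive there, hence vanish,
  and as \<open>T\<^sub>i\<close> is invertible \<open>\<Psi>\<^sub>i(1 - u u\<^sup>*) = 0\<close>.  In the Holevo form of \<open>\<Psi>\<^sub>i\<close> this confines every vector
  with a nonzero coefficient to the line through \<open>u\<close>, so that \<open>\<Psi>\<^sub>i\<close> is the pure state itself.
\<close>

section \<open>Positive semidefinite kernels\<close>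

definition sesq_form :: "'i set \<Rightarrow> ('i \<Rightarrow> 'i \<Rightarrow> complex) \<Rightarrow> ('i \<Rightarrow> complex) \<Rightarrow> ('i \<Rightarrow> complex) \<Rightarrow> complex" where
  "sesq_form I A v w = (\<Sum>p\<in>I. \<Sum>q\<in>I. cnj (v p) * A p q * w q)"

lemma psd_on_iff_sesq_form_nonneg: "psd_on I A \<longleftrightarrow> (\<forall>v. 0 \<le> sesq_form I A v v)"
  by (auto simp: psd_on_def sesq_form_def less_eq_complex_def complex_is_Real_iff)

lemma sesq_form_add_left: "sesq_form I A (\<lambda>p. v p + w p) x = sesq_form I A v x + sesq_form I A w x"
  by (simp add: sesq_form_def algebra_simps sum.distrib)

lemma sesq_form_add_right: "sesq_form I A x (\<lambda>p. v p + w p) = sesq_form I A x v + sesq_form I A x w"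
  by (simp add: sesq_form_def algebra_simps sum.distrib)

lemma sesq_form_scale_left: "sesq_form I A (\<lambda>p. c * v p) x = cnj c * sesq_form I A v x"
  by (simp add: sesq_form_def sum_distrib_left mult.assoc)

lemma sesq_form_scale_right: "sesq_form I A x (\<lambda>p. c * v p) = c * sesq_form I A x v"
  by (simp add: sesq_form_def sum_distrib_left mult_ac)

lemma sesq_form_unit_vectors:
  assumes "finite I" "i \<in> I" "j \<in> I"
  shows "sesq_form I A (\<lambda>p. of_bool (p = i)) (\<lambda>p. of_bool (p = j)) = A i j"
proof -
  have "sesq_form I A (\<lambda>p. of_bool (p = i)) (\<lambda>p. of_bool (p = j))
      = (\<Sum>p\<in>I. if p = i then \<Sum>q\<in>I. if q = j then A i j else 0 else 0)"
    unfolding sesq_form_def by (intro sum.cong refl) (auto intro!: sum.cong)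
  then show ?thesis
    using assms by simp
qed

text \<open>
  Polarisation: the form is real at \<open>v + w\<close> and at \<open>v + \<i> w\<close>, and the two resulting conditions on the
  cross terms are the imaginary and the real part of the claim.
\<close>

lemma psd_on_hermitian_form:
  assumes "psd_on I A"
  shows "sesq_form I A w v = cnj (sesq_form I A v w)"
proof -
  have real: "Im (sesq_form I A x x) = 0" for x
    using assms by (simp add: psd_on_iff_sesq_form_nonneg less_eq_complex_def)
  have "Im (sesq_form I A v w + sesq_form I A w v) = 0"
    using real[of "\<lambda>p. v p + w p"] real[of v] real[of w]
    by (simp add: sesq_form_add_left sesq_form_add_right)
  moreover have "Im (\<i> * sesq_form I A v w - \<i> * sesq_form I A w v) = 0"
    using real[of "\<lambda>p. v p + \<i> * w p"] real[of v] real[of w]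
    by (simp add: sesq_form_add_left sesq_form_add_right sesq_form_scale_left sesq_form_scale_right)
  ultimately show ?thesis
    by (simp add: complex_eq_iff)
qed

text \<open>
  If \<open>v\<close> is isotropic, then the form at \<open>w + t v\<close> is affine in the scalar \<open>t\<close>, with slope
  determined by \<open>\<langle>w, A v\<rangle>\<close>; it can stay nonnegative for all \<open>t\<close> only if that slope vanishes.
\<close>

lemma psd_on_isotropic_form:
  assumes "psd_on I A" "sesq_form I A v v = 0"
  shows "sesq_form I A w v = 0"
proof (rule ccontr)
  define s where "s = sesq_form I A w v"
  assume "sesq_form I A w v \<noteq> 0"
  then have pos: "(cmod s)\<^sup>2 > 0"
    by (simp add: s_def)
  \<comment> \<open>The scalar is chosen to make the form at \<open>w + t v\<close> equal to \<open>-1\<close>.\<close>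
  define r where "r = (Re (sesq_form I A w w) + 1) / (2 * (cmod s)\<^sup>2)"
  define t where "t = - of_real r * cnj s"
  have "sesq_form I A (\<lambda>p. w p + t * v p) (\<lambda>p. w p + t * v p)
      = sesq_form I A w w + (t * s + cnj (t * s))"
    using assms(2) psd_on_hermitian_form[OF assms(1), of v w]
    by (simp add: sesq_form_add_left sesq_form_add_right sesq_form_scale_left sesq_form_scale_right s_def)
  then have "0 \<le> Re (sesq_form I A w w + (t * s + cnj (t * s)))"
    using assms(1) by (metis psd_on_iff_sesq_form_nonneg less_eq_complex_def zero_complex.sel(1))
  moreover have "t * s = - of_real (r * (cmod s)\<^sup>2)"
    by (simp only: t_def complex_norm_square of_real_mult) (simp add: mult_ac)
  ultimately have "2 * (r * (cmod s)\<^sup>2) \<le> Re (sesq_form I A w w)"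
    by simp
  moreover have "2 * (r * (cmod s)\<^sup>2) = Re (sesq_form I A w w) + 1"
    using pos by (simp add: r_def)
  ultimately show False
    by simp
qed

lemma sesq_form_insert:
  assumes "finite I" "a \<notin> I"
  shows "sesq_form (insert a I) A x x =
    cnj (x a) * A a a * x a + cnj (x a) * (\<Sum>j\<in>I. A a j * x j) + (\<Sum>i\<in>I. cnj (x i) * A i a) * x a
      + sesq_form I A x x"
  using assms
  by (simp add: sesq_form_def sum.distrib sum_distrib_left sum_distrib_right mult.assoc add.assoc)

text \<open>
  Completing the square: minimising the form of \<open>A\<close> over the coordinate at the pivot \<open>a\<close> gives the
  form of the Schur complement.
\<close>

lemma psd_on_schur_complement:
  assumes fin: "finite I" and "a \<notin> I" and psd: "psd_on (insert a I) A" and nz: "A a a \<noteq> 0"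
    and herm: "\<And>i. i \<in> I \<Longrightarrow> A i a = cnj (A a i)"
  shows "psd_on I (\<lambda>i j. A i j - A i a * A a j / A a a)"
  unfolding psd_on_iff_sesq_form_nonneg
proof
  fix v
  define s where "s = (\<Sum>j\<in>I. A a j * v j)"
  define x where "x = v(a := - s / A a a)"
  have xI: "x i = v i" if "i \<in> I" for i
    using that \<open>a \<notin> I\<close> by (auto simp: x_def)
  have row: "(\<Sum>j\<in>I. A a j * x j) = s" and col: "(\<Sum>i\<in>I. cnj (x i) * A i a) = cnj s"
    by (simp_all add: s_def xI herm mult.commute)
  have pivot: "cnj (A a a) = A a a"
    using psd_on_hermitian_form[OF psd] sesq_form_unit_vectors[of "insert a I" a a A] fin
    by (metis finite_insert insertI1)
  have "sesq_form I A x x = sesq_form I A v v"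
    by (simp add: sesq_form_def xI)
  then have "sesq_form (insert a I) A x x = sesq_form I A v v - cnj s * s / A a a"
    using fin \<open>a \<notin> I\<close> nz by (simp add: sesq_form_insert row col) (simp add: x_def pivot)
  moreover have "sesq_form I (\<lambda>i j. A i j - A i a * A a j / A a a) v v
      = sesq_form I A v v - cnj s * s / A a a"
  proof -
    have "cnj s = (\<Sum>i\<in>I. cnj (v i) * A i a)"
      using col by (simp add: xI)
    then have "cnj s * s / A a a = (\<Sum>i\<in>I. \<Sum>j\<in>I. cnj (v i) * (A i a * A a j / A a a) * v j)"
      by (simp only: s_def sum_product sum_divide_distrib) (simp add: mult_ac)
    then show ?thesis
      by (simp add: sesq_form_def sum_subtractf[symmetric] algebra_simps)
  qed
  ultimately show "0 \<le> sesq_form I (\<lambda>i j. A i j - A i a * A a j / A a a) v v"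
    using psd by (metis psd_on_iff_sesq_form_nonneg)
qed

lemma obtain_real_sqrt:
  fixes z :: complex
  assumes "0 \<le> z" "z \<noteq> 0"
  obtains c where "c * c = z" "cnj c = c" "c \<noteq> 0"
proof
  have z: "0 \<le> Re z" "z = of_real (Re z)"
    using assms(1) by (auto simp: less_eq_complex_def complex_eq_iff)
  define c where "c = complex_of_real (sqrt (Re z))"
  have "c * c = of_real (Re z)"
    using z(1) by (simp add: c_def flip: of_real_mult)
  then show c: "c * c = z"
    using z(2) by simp
  then show "c \<noteq> 0"
    using assms(2) by auto
  show "cnj c = c"
    by (simp add: c_def)
qed

text \<open>
  Cholesky decomposition: split off the rank-one kernel with the same pivot row as \<open>A\<close> and continue
  with the Schur complement.  A vanishing pivot forces its whole row to vanish.
\<close>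

lemma psd_on_rank_one_decomposition:
  assumes "finite I" "psd_on I A"
  shows "\<exists>(n::nat) w. \<forall>i\<in>I. \<forall>j\<in>I. A i j = (\<Sum>m<n. w m i * cnj (w m j))"
  using assms
proof (induction I arbitrary: A rule: finite_induct)
  case empty
  then show ?case by simp
next
  case (insert a I)
  note unit = sesq_form_unit_vectors[of "insert a I" _ _ A]
  have herm: "A j i = cnj (A i j)" if "i \<in> insert a I" "j \<in> insert a I" for i j
    using unit that insert.hyps(1) psd_on_hermitian_form[OF insert.prems]
    by (metis finite_insert)
  show ?case
  proof (cases "A a a = 0")
    case True
    have col: "A i a = 0" if "i \<in> insert a I" for i
      using unit that insert.hyps(1) psd_on_isotropic_form[OF insert.prems] True
      by (metis finite_insert insertI1)
    then have row: "A a i = 0" if "i \<in> insert a I" for i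
      using herm[of i a] that by simp
    have "sesq_form I A v v = sesq_form (insert a I) A v v" for v
      using insert.hyps col row by (simp add: sesq_form_insert)
    then have "psd_on I A"
      using insert.prems by (simp add: psd_on_iff_sesq_form_nonneg)
    then obtain n :: nat and w where w: "\<And>i j. i \<in> I \<Longrightarrow> j \<in> I \<Longrightarrow> A i j = (\<Sum>m<n. w m i * cnj (w m j))"
      using insert.IH by blast
    have "A i j = (\<Sum>m<n. ((w m)(a := 0)) i * cnj (((w m)(a := 0)) j))"
      if "i \<in> insert a I" "j \<in> insert a I" for i j
      using that col row w insert.hyps(2) by (cases "i = a \<or> j = a") auto
    then show ?thesis
      by (intro exI[of _ n] exI[of _ "\<lambda>m. (w m)(a := 0)"]) blast
  next
    case False
    have "psd_on I (\<lambda>i j. A i j - A i a * A a j / A a a)"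
      by (rule psd_on_schur_complement[OF insert.hyps(1,2) insert.prems False], rule herm) simp_all
    then obtain n :: nat and w where w:
      "\<And>i j. i \<in> I \<Longrightarrow> j \<in> I \<Longrightarrow> A i j - A i a * A a j / A a a = (\<Sum>m<n. w m i * cnj (w m j))"
      using insert.IH by blast
    have "0 \<le> A a a"
      using insert.prems unit[of a a] insert.hyps(1)
      by (metis finite_insert insertI1 psd_on_iff_sesq_form_nonneg)
    then obtain c where c: "c * c = A a a" "cnj c = c" "c \<noteq> 0"
      using False by (rule obtain_real_sqrt)
    \<comment> \<open>The vector \<open>x 0\<close> alone accounts for the pivot row; the others are constrained only on \<open>I\<close>.\<close>
    define x where "x m = (case m of 0 \<Rightarrow> (\<lambda>i. A i a / c) | Suc m \<Rightarrow> (w m)(a := 0))" for m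
    have "A i j = (\<Sum>m<Suc n. x m i * cnj (x m j))"
      if ij: "i \<in> insert a I" "j \<in> insert a I" for i j
    proof -
      have "x 0 i * cnj (x 0 j) = A i a * A a j / A a a"
        using herm[of j a] ij by (simp add: x_def c(2) flip: c(1))
      moreover have "(\<Sum>m<n. x (Suc m) i * cnj (x (Suc m) j)) = A i j - A i a * A a j / A a a"
        using ij w False by (cases "i = a \<or> j = a") (auto simp: x_def)
      ultimately show ?thesis
        by (simp add: sum.lessThan_Suc_shift del: sum.lessThan_Suc)
    qed
    then show ?thesis
      by blast
  qed
qed

lemma cnj_mult_self_nonneg: "0 \<le> cnj z * z"
  by (simp add: less_eq_complex_def)

lemma psd_on_rank_one:
  shows "psd_on I (\<lambda>p q. w p * cnj (w q))"
  unfolding psd_on_iff_sesq_form_nonneg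
proof
  fix v
  have "sesq_form I (\<lambda>p q. w p * cnj (w q)) v v = (\<Sum>p\<in>I. cnj (v p) * w p) * (\<Sum>q\<in>I. cnj (w q) * v q)"
    by (simp only: sesq_form_def sum_product mult.assoc)
  also have "(\<Sum>p\<in>I. cnj (v p) * w p) = cnj (\<Sum>q\<in>I. cnj (w q) * v q)"
    by (simp add: mult.commute)
  finally have "sesq_form I (\<lambda>p q. w p * cnj (w q)) v v = cnj (\<Sum>q\<in>I. cnj (w q) * v q) * (\<Sum>q\<in>I. cnj (w q) * v q)" .
  then show "0 \<le> sesq_form I (\<lambda>p q. w p * cnj (w q)) v v"
    by (simp only: cnj_mult_self_nonneg)
qed


section \<open>Quadratic forms of matrices\<close>

definition cinner :: "complex^'d \<Rightarrow> complex^'d::finite \<Rightarrow> complex" where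
  "cinner v w = (\<Sum>a\<in>UNIV. cnj (v $ a) * w $ a)"

definition quad_form :: "complex^'d \<Rightarrow> 'd::finite cmat \<Rightarrow> complex" where
  "quad_form v X = cinner v (X *v v)"

definition outer :: "complex^'d \<Rightarrow> 'd::finite cmat" where
  "outer b = (\<chi> i j. b $ i * cnj (b $ j))"

lemma quad_form_eq_sum: "quad_form v X = (\<Sum>a\<in>UNIV. \<Sum>b\<in>UNIV. cnj (v $ a) * X $ a $ b * v $ b)"
  by (simp add: quad_form_def cinner_def matrix_vector_mult_def sum_distrib_left mult.assoc)

lemma quad_form_add: "quad_form v (X + Y) = quad_form v X + quad_form v Y"
  by (simp add: quad_form_eq_sum algebra_simps sum.distrib)

lemma quad_form_sum: "quad_form v (\<Sum>i\<in>S. X i) = (\<Sum>i\<in>S. quad_form v (X i))"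
  by (induction S rule: infinite_finite_induct) (simp_all add: quad_form_add, simp_all add: quad_form_eq_sum)

lemma quad_form_cscale: "quad_form v (cscale c X) = c * quad_form v X"
  by (simp add: quad_form_eq_sum cscale_def sum_distrib_left mult_ac)

lemma quad_form_scale: "quad_form (c *s v) X = cnj c * c * quad_form v X"
  by (simp add: quad_form_eq_sum sum_distrib_left mult_ac)

lemma quad_form_mat_1: "quad_form v (mat 1) = cinner v v"
  by (simp add: quad_form_def)

lemma cinner_adj: "cinner v (adj T *v w) = cinner (T *v v) w"
proof -
  have "cinner v (adj T *v w) = (\<Sum>a\<in>UNIV. \<Sum>b\<in>UNIV. cnj (v $ a) * cnj (T $ b $ a) * w $ b)"
    by (simp add: cinner_def matrix_vector_mult_def adj_def transpose_def sum_distrib_left mult.assoc)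
  also have "\<dots> = (\<Sum>b\<in>UNIV. \<Sum>a\<in>UNIV. cnj (v $ a) * cnj (T $ b $ a) * w $ b)"
    by (rule sum.swap)
  also have "\<dots> = cinner (T *v v) w"
    by (simp add: cinner_def matrix_vector_mult_def sum_distrib_right mult.commute[of "cnj (v $ _)"])
  finally show ?thesis .
qed

lemma quad_form_Ad: "quad_form v (Ad T X) = quad_form (T *v v) X"
  by (simp add: quad_form_def Ad_def cinner_adj flip: matrix_vector_mul_assoc)

lemma cinner_self_nonneg: "0 \<le> cinner v v"
  unfolding cinner_def by (intro sum_nonneg cnj_mult_self_nonneg)

lemma cinner_self_eq_0_iff: "cinner v v = 0 \<longleftrightarrow> v = 0"
  unfolding cinner_def
  by (subst sum_nonneg_eq_0_iff) (auto simp: vec_eq_iff cnj_mult_self_nonneg)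

lemma quad_form_outer: "quad_form v (outer b) = cnj (cinner b v) * cinner b v"
proof -
  have "quad_form v (outer b) = (\<Sum>a\<in>UNIV. cnj (v $ a) * b $ a) * cinner b v"
    by (simp add: quad_form_eq_sum outer_def cinner_def sum_product mult_ac)
  then show ?thesis
    by (simp add: cinner_def mult.commute)
qed

lemma quad_form_outer_nonneg: "0 \<le> quad_form v (outer b)"
  by (simp only: quad_form_outer cnj_mult_self_nonneg)

lemma cinner_diff_left: "cinner (v - w) x = cinner v x - cinner w x"
  by (simp add: cinner_def algebra_simps sum_subtractf)

lemma cinner_diff_right: "cinner x (v - w) = cinner x v - cinner x w"
  by (simp add: cinner_def algebra_simps sum_subtractf)

lemma cinner_scale_left: "cinner (c *s v) x = cnj c * cinner v x"
  by (simp add: cinner_def sum_distrib_left mult_ac)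

lemma cinner_scale_right: "cinner x (c *s v) = c * cinner x v"
  by (simp add: cinner_def sum_distrib_left mult_ac)

lemma cinner_commute: "cinner v w = cnj (cinner w v)"
  by (simp add: cinner_def mult.commute)

text \<open>
  The right-hand side is the squared distance from \<open>v\<close> to the line through \<open>u\<close>; it vanishes
  exactly on that line.
\<close>

lemma quad_form_orthogonal_projection:
  assumes "cinner u u = 1"
  shows "quad_form v (mat 1 - outer u) = cinner (v - cinner u v *s u) (v - cinner u v *s u)"
proof -
  have "quad_form v (mat 1 - outer u) + quad_form v (outer u) = cinner v v"
    by (simp flip: quad_form_add quad_form_mat_1)
  then show ?thesis
    using assms cinner_commute[of v u]
    by (simp add: quad_form_outer cinner_diff_left cinner_diff_right cinner_scale_left
        cinner_scale_right algebra_simps)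
qed

text \<open>
  The zero vector is the multiple \<open>0 u\<close> of an arbitrary unit vector \<open>u\<close>, so that vectors in a Holevo
  form can be normalised without discarding any term.
\<close>

lemma obtain_unit_multiple:
  fixes v :: "complex^'d::finite"
  obtains c u where "cinner u u = 1" "v = c *s u"
proof (cases "v = 0")
  case True
  have "cinner (axis a 1) (axis a 1 :: complex^'d) = 1" for a
    by (simp add: cinner_def axis_def if_distrib if_distribR cong: if_cong)
  then show ?thesis
    using True that[of _ 0] by auto
next
  case False
  then obtain c where c: "c * c = cinner v v" "cnj c = c" "c \<noteq> 0"
    using obtain_real_sqrt[OF cinner_self_nonneg] by (metis cinner_self_eq_0_iff)
  show ?thesis
  proof
    show "cinner (inverse c *s v) (inverse c *s v) = 1"
      using c(2,3) by (simp add: cinner_scale_left cinner_scale_right c(1)[symmetric] mult.assoc[symmetric])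
    show "v = c *s (inverse c *s v)"
      using c by (simp add: vec_eq_iff)
  qed
qed

lemma Ad_nth: "Ad T X $ i $ j = (\<Sum>a\<in>UNIV. \<Sum>b\<in>UNIV. cnj (T $ a $ i) * X $ a $ b * T $ b $ j)"
proof -
  have "Ad T X $ i $ j = (\<Sum>b\<in>UNIV. \<Sum>a\<in>UNIV. cnj (T $ a $ i) * X $ a $ b * T $ b $ j)"
    unfolding Ad_def adj_def transpose_def matrix_matrix_mult_def by (simp add: sum_distrib_right)
  also have "\<dots> = (\<Sum>a\<in>UNIV. \<Sum>b\<in>UNIV. cnj (T $ a $ i) * X $ a $ b * T $ b $ j)"
    by (rule sum.swap)
  finally show ?thesis .
qed

lemma Ad_add: "Ad T (X + Y) = Ad T X + Ad T Y"
  by (simp add: vec_eq_iff Ad_nth algebra_simps sum.distrib)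

lemma Ad_sum: "Ad T (\<Sum>i\<in>S. X i) = (\<Sum>i\<in>S. Ad T (X i))"
  by (induction S rule: infinite_finite_induct) (simp_all add: Ad_add, simp_all add: vec_eq_iff Ad_nth)

lemma Ad_cscale: "Ad T (cscale c X) = cscale c (Ad T X)"
  by (simp add: vec_eq_iff Ad_nth cscale_def sum_distrib_left mult_ac)

lemma adj_mat_1: "adj (mat 1) = mat 1"
  by (auto simp: vec_eq_iff adj_def transpose_def mat_def)

lemma Ad_mat_1: "Ad T (mat 1) = adj T ** T"
  by (simp add: Ad_def)

lemma Ad_outer: "Ad T (outer b) = outer (adj T *v b)"
proof -
  have "Ad T (outer b) $ i $ j = outer (adj T *v b) $ i $ j" for i j
  proof -
    have "outer (adj T *v b) $ i $ j
        = (\<Sum>a\<in>UNIV. cnj (T $ a $ i) * b $ a) * (\<Sum>a\<in>UNIV. cnj (b $ a) * T $ a $ j)"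
      by (simp add: outer_def adj_def transpose_def matrix_vector_mult_def mult.commute)
    also have "\<dots> = Ad T (outer b) $ i $ j"
      by (simp only: Ad_nth sum_product outer_def vec_lambda_beta mult.assoc)
    finally show ?thesis ..
  qed
  then show ?thesis
    by (simp add: vec_eq_iff)
qed

lemma cscale_sum_right: "cscale c (\<Sum>i\<in>S. X i) = (\<Sum>i\<in>S. cscale c (X i))"
  by (simp add: vec_eq_iff cscale_def sum_distrib_left)

lemma cscale_sum_left: "cscale (\<Sum>i\<in>S. c i) X = (\<Sum>i\<in>S. cscale (c i) X)"
  by (simp add: vec_eq_iff cscale_def sum_distrib_right)

lemma cscale_add_left: "cscale (c + d) X = cscale c X + cscale d X"
  by (simp add: vec_eq_iff cscale_def algebra_simps)

lemma cscale_cscale: "cscale c (cscale d X) = cscale (c * d) X"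
  by (simp add: vec_eq_iff cscale_def mult_ac)

lemma cscale_1: "cscale 1 X = X"
  by (simp add: vec_eq_iff cscale_def)

lemma cscale_0_right: "cscale c 0 = 0"
  by (simp add: vec_eq_iff cscale_def)

lemma cscale_0: "cscale 0 X = 0"
  by (simp add: vec_eq_iff cscale_def)

lemma outer_0: "outer 0 = 0"
  by (simp add: vec_eq_iff outer_def)

lemma mat_1_eq_sum_outer: "(mat 1 :: 'd::finite cmat) = (\<Sum>a\<in>UNIV. outer (axis a 1))"
proof -
  have "outer (axis a 1 :: complex^'d) $ i $ j = (if i = a then mat 1 $ i $ j else 0)" for a i j
    by (auto simp: outer_def axis_def mat_def)
  then show ?thesis
    by (simp add: vec_eq_iff)
qed

section \<open>Entanglement breaking maps in Holevo form\<close>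

text \<open>
  The vectors are not normalised and no unitality is imposed: in this way the maps form a convex cone,
  and closure properties can be proved term by term.
\<close>

definition holevo :: "('a::finite cmat \<Rightarrow> 'b::finite cmat) \<Rightarrow> bool" where
  "holevo \<Phi> \<longleftrightarrow> (\<exists>(n::nat) u b. \<Phi> = (\<lambda>X. \<Sum>l<n. cscale (quad_form (u l) X) (outer (b l))))"

lemma holevo_zero: "holevo (\<lambda>X. 0)"
  unfolding holevo_def by (rule exI[of _ 0]) simp

lemma holevo_atom: "holevo (\<lambda>X. cscale (quad_form u X) (outer b))"
  unfolding holevo_def by (rule exI[of _ 1]) auto

lemma holevo_add:
  assumes "holevo \<Phi>" "holevo \<Psi>"
  shows "holevo (\<lambda>X. \<Phi> X + \<Psi> X)"
proof -
  obtain n :: nat and u b where \<Phi>: "\<Phi> = (\<lambda>X. \<Sum>l<n. cscale (quad_form (u l) X) (outer (b l)))"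
    using assms(1) unfolding holevo_def by blast
  obtain m :: nat and v c where \<Psi>: "\<Psi> = (\<lambda>X. \<Sum>l<m. cscale (quad_form (v l) X) (outer (c l)))"
    using assms(2) unfolding holevo_def by blast
  define u' where "u' l = (if l < n then u l else v (l - n))" for l
  define b' where "b' l = (if l < n then b l else c (l - n))" for l
  have "(\<Sum>l<n + m. cscale (quad_form (u' l) X) (outer (b' l))) = \<Phi> X + \<Psi> X" for X
  proof -
    have split: "(\<Sum>l<n + m. f l) = (\<Sum>l<n. f l) + (\<Sum>l<m. f (n + l))" for f :: "nat \<Rightarrow> 'b cmat"
      by (induction m) (simp_all add: add.assoc)
    show ?thesis
      unfolding split by (simp add: \<Phi> \<Psi> u'_def b'_def)
  qed
  then have "(\<lambda>X. \<Phi> X + \<Psi> X) = (\<lambda>X. \<Sum>l<n + m. cscale (quad_form (u' l) X) (outer (b' l)))"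
    by simp
  then show ?thesis
    unfolding holevo_def by blast
qed

lemma holevo_sum:
  assumes "\<And>i. i \<in> S \<Longrightarrow> holevo (\<Phi> i)"
  shows "holevo (\<lambda>X. \<Sum>i\<in>S. \<Phi> i X)"
  using assms
  by (induction S rule: infinite_finite_induct) (simp_all add: holevo_zero holevo_add)

lemma holevo_Ad:
  assumes "holevo \<Phi>"
  shows "holevo (\<lambda>X. Ad T (\<Phi> X))"
proof -
  obtain n :: nat and u b where "\<Phi> = (\<lambda>X. \<Sum>l<n. cscale (quad_form (u l) X) (outer (b l)))"
    using assms unfolding holevo_def by blast
  then show ?thesis
    by (simp add: Ad_sum Ad_cscale Ad_outer holevo_sum holevo_atom)
qed

lemma psd_on_sum:
  assumes "\<And>l. l \<in> S \<Longrightarrow> psd_on I (A l)"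
  shows "psd_on I (\<lambda>p q. \<Sum>l\<in>S. A l p q)"
  unfolding psd_on_iff_sesq_form_nonneg
proof
  fix v
  have "sesq_form I (\<lambda>p q. \<Sum>l\<in>S. A l p q) v v = (\<Sum>p\<in>I. \<Sum>q\<in>I. \<Sum>l\<in>S. cnj (v p) * A l p q * v q)"
    by (simp add: sesq_form_def sum_distrib_left sum_distrib_right)
  also have "\<dots> = (\<Sum>l\<in>S. sesq_form I (A l) v v)"
    by (simp add: sesq_form_def sum.swap[of _ S])
  also have "0 \<le> \<dots>"
    using assms by (intro sum_nonneg) (simp add: psd_on_iff_sesq_form_nonneg)
  finally show "0 \<le> sesq_form I (\<lambda>p q. \<Sum>l\<in>S. A l p q) v v" .
qed

text \<open>
  The matrix of the quadratic forms of all blocks of \<open>X\<close> is the compression of \<open>X\<close> to the product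
  vectors \<open>v \<otimes> u\<close> with \<open>u\<close> fixed.
\<close>

lemma psd_on_compress:
  assumes "psd_tensor k (X :: 'd::finite tmat)"
  shows "psd_on {..<k} (\<lambda>i j. quad_form u (\<chi> a b. X (i, a) (j, b)))"
  unfolding psd_on_iff_sesq_form_nonneg
proof
  fix v
  have "sesq_form {..<k} (\<lambda>i j. quad_form u (\<chi> a b. X (i, a) (j, b))) v v
     = (\<Sum>i<k. \<Sum>j<k. \<Sum>a\<in>UNIV. \<Sum>b\<in>UNIV. cnj (v i * u $ a) * X (i, a) (j, b) * (v j * u $ b))"
    by (simp add: sesq_form_def quad_form_eq_sum sum_distrib_left sum_distrib_right mult_ac)
  also have "\<dots> = (\<Sum>i<k. \<Sum>a\<in>UNIV. \<Sum>j<k. \<Sum>b\<in>UNIV. cnj (v i * u $ a) * X (i, a) (j, b) * (v j * u $ b))"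
    by (intro sum.cong refl sum.swap)
  also have "\<dots> = sesq_form ({..<k} \<times> UNIV) X (\<lambda>(i, a). v i * u $ a) (\<lambda>(i, a). v i * u $ a)"
    by (simp add: sesq_form_def sum.cartesian_product')
  also have "0 \<le> \<dots>"
    using assms by (simp add: psd_tensor_def psd_on_iff_sesq_form_nonneg)
  finally show "0 \<le> sesq_form {..<k} (\<lambda>i j. quad_form u (\<chi> a b. X (i, a) (j, b))) v v" .
qed

lemma psd_outer: "psd (outer b)"
  by (simp add: psd_def outer_def psd_on_rank_one)

text \<open>
  The form of \<open>A \<otimes> b b\<^sup>*\<close> at \<open>v\<close> is the form of \<open>A\<close> at the vector obtained by pairing the second tensor
  factor of \<open>v\<close> with \<open>b\<close>.
\<close>

lemma psd_tensor_kron_outer: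
  assumes "psd_on {..<k} A"
  shows "psd_tensor k (kron A (outer b))"
  unfolding psd_tensor_def psd_on_iff_sesq_form_nonneg
proof
  fix v :: "nat \<times> 'a \<Rightarrow> complex"
  define w where "w j = (\<Sum>a\<in>UNIV. cnj (b $ a) * v (j, a))" for j
  have "sesq_form ({..<k} \<times> UNIV) (kron A (outer b)) v v
     = (\<Sum>i<k. \<Sum>a\<in>UNIV. \<Sum>j<k. \<Sum>c\<in>UNIV. cnj (v (i, a)) * (A i j * (b $ a * cnj (b $ c))) * v (j, c))"
    by (simp add: sesq_form_def sum.cartesian_product' kron_def outer_def)
  also have "\<dots> = (\<Sum>i<k. \<Sum>j<k. \<Sum>a\<in>UNIV. \<Sum>c\<in>UNIV. cnj (v (i, a)) * (A i j * (b $ a * cnj (b $ c))) * v (j, c))"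
    by (intro sum.cong refl sum.swap)
  also have "\<dots> = sesq_form {..<k} A w w"
  proof -
    have "(\<Sum>a\<in>UNIV. \<Sum>c\<in>UNIV. cnj (v (i, a)) * (A i j * (b $ a * cnj (b $ c))) * v (j, c))
        = cnj (w i) * A i j * w j" for i j
    proof -
      have "cnj (w i) * A i j * w j
          = A i j * ((\<Sum>a\<in>UNIV. b $ a * cnj (v (i, a))) * (\<Sum>c\<in>UNIV. cnj (b $ c) * v (j, c)))"
        by (simp add: w_def)
      also have "\<dots> = (\<Sum>a\<in>UNIV. \<Sum>c\<in>UNIV. cnj (v (i, a)) * (A i j * (b $ a * cnj (b $ c))) * v (j, c))"
        by (simp only: sum_product, simp only: sum_distrib_left) (intro sum.cong refl, simp only: mult_ac)
      finally show ?thesis ..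
    qed
    then show ?thesis
      by (simp add: sesq_form_def)
  qed
  also have "0 \<le> \<dots>"
    using assms by (simp add: psd_on_iff_sesq_form_nonneg)
  finally show "0 \<le> sesq_form ({..<k} \<times> UNIV) (kron A (outer b)) v v" .
qed

text \<open>
  Each term of the Holevo form turns \<open>X\<close> into a product of a compression of \<open>X\<close> with a rank-one matrix.
\<close>

lemma separable_of_holevo:
  fixes \<Phi> :: "'a::finite cmat \<Rightarrow> 'b::finite cmat"
  assumes "holevo \<Phi>" "psd_tensor k X"
  shows "separable k (id_tensor \<Phi> X)"
proof -
  obtain n :: nat and u b where \<Phi>: "\<Phi> = (\<lambda>X. \<Sum>l<n. cscale (quad_form (u l) X) (outer (b l)))"
    using assms(1) unfolding holevo_def by blast
  define A where "A l = (\<lambda>i j. quad_form (u l) (\<chi> a b. X (i, a) (j, b)))" for l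
  have eq: "id_tensor \<Phi> X = (\<lambda>p q. \<Sum>l<n. kron (A l) (outer (b l)) p q)"
    by (auto simp: fun_eq_iff id_tensor_def \<Phi> kron_def A_def cscale_def)
  have A: "psd_on {..<k} (A l)" for l
    unfolding A_def by (rule psd_on_compress[OF assms(2)])
  have "psd_tensor k (id_tensor \<Phi> X)"
    unfolding eq psd_tensor_def
    by (intro psd_on_sum) (use A psd_tensor_kron_outer psd_tensor_def in blast)
  then show ?thesis
    unfolding separable_def using A
    by (intro conjI exI[of _ n] exI[of _ A] exI[of _ "\<lambda>l. outer (b l)"]) (simp_all add: eq psd_outer)
qed

lemma entanglement_breaking_of_holevo:
  assumes "holevo \<Phi>"
  shows "entanglement_breaking \<Phi>"
proof -
  obtain n :: nat and u b where \<Phi>: "\<Phi> = (\<lambda>X. \<Sum>l<n. cscale (quad_form (u l) X) (outer (b l)))"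
    using assms unfolding holevo_def by blast
  have "complex_linear \<Phi>"
    unfolding complex_linear_iff \<Phi>
    by (simp add: quad_form_add quad_form_cscale cscale_sum_right cscale_cscale cscale_add_left sum.distrib)
  then show ?thesis
    using separable_of_holevo[OF assms]
    by (auto simp: entanglement_breaking_def completely_positive_def separable_def)
qed

text \<open>
  The blocks of the maximally entangled state are the matrix units, so a separable decomposition of
  its image expresses \<open>\<Phi>\<close> at all matrix units, hence everywhere by linearity.  A rank-one piece
  \<open>w w\<^sup>*\<close> of the first tensor factor acts on \<open>X\<close> as the quadratic form at the conjugate vector of \<open>w\<close>.
\<close>

lemma holevo_of_entanglement_breaking:
  fixes \<Phi> :: "'a::finite cmat \<Rightarrow> 'b::finite cmat"
  assumes "entanglement_breaking \<Phi>"
  shows "holevo \<Phi>"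
proof -
  define k where "k = CARD('a)"
  obtain h where h: "bij_betw h {..<k} (UNIV :: 'a set)"
    using ex_bij_betw_nat_finite[of "UNIV :: 'a set"] by (auto simp: k_def atLeast0LessThan)
  define g where "g = inv_into {..<k} h"
  have g: "g c < k" "h (g c) = c" for c
    using h by (auto simp: g_def bij_betw_def f_inv_into_f)
      (metis UNIV_I inv_into_into lessThan_iff)
  \<comment> \<open>\<open>e e\<^sup>*\<close> is the maximally entangled state, where \<open>h\<close> identifies the two index sets.\<close>
  define e :: "nat \<times> 'a \<Rightarrow> complex" where "e = (\<lambda>(i, a). if h i = a then 1 else 0)"
  define E :: "'a \<Rightarrow> 'a \<Rightarrow> 'a cmat" where "E c d = (\<chi> a b. if c = a \<and> d = b then 1 else 0)" for c d
  have "k \<ge> 1"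
    by (simp add: k_def Suc_leI)
  moreover have "psd_tensor k (\<lambda>p q. e p * cnj (e q))"
    by (simp add: psd_tensor_def psd_on_rank_one)
  ultimately have "separable k (id_tensor \<Phi> (\<lambda>p q. e p * cnj (e q)))"
    using assms unfolding entanglement_breaking_def by blast
  then obtain n :: nat and A B where A: "\<And>l. l < n \<Longrightarrow> psd_on {..<k} (A l)" and B: "\<And>l. l < n \<Longrightarrow> psd (B l)"
    and eq: "\<And>p q. p \<in> {..<k} \<times> UNIV \<Longrightarrow> q \<in> {..<k} \<times> UNIV \<Longrightarrow>
      id_tensor \<Phi> (\<lambda>p q. e p * cnj (e q)) p q = (\<Sum>l<n. kron (A l) (B l) p q)"
    unfolding separable_def by blast
  have \<Phi>E: "\<Phi> (E c d) = (\<Sum>l<n. cscale (A l (g c) (g d)) (B l))" for c d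
  proof -
    have "(\<chi> a b. e (g c, a) * cnj (e (g d, b))) = E c d"
      by (simp add: vec_eq_iff e_def E_def g)
    then have "\<Phi> (E c d) $ a $ b = (\<Sum>l<n. A l (g c) (g d) * B l $ a $ b)" for a b
      using eq[of "(g c, a)" "(g d, b)"] g by (simp add: id_tensor_def kron_def)
    then show ?thesis
      by (simp add: vec_eq_iff cscale_def)
  qed
  have lin: "\<Phi> (X + Y) = \<Phi> X + \<Phi> Y" "\<Phi> (cscale c X) = cscale c (\<Phi> X)" for X Y c
    using assms by (auto simp: entanglement_breaking_def completely_positive_def complex_linear_iff)
  have lin0: "\<Phi> 0 = 0"
    using lin(2)[of 0 0] by (simp add: cscale_0)
  have lin_sum: "\<Phi> (\<Sum>i\<in>S. X i) = (\<Sum>i\<in>S. \<Phi> (X i))" if "finite S" for S :: "'a set" and X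
    using that by (induction S rule: finite_induct) (simp_all add: lin lin0)
  have "\<exists>(m::nat) w. \<forall>i\<in>{..<k}. \<forall>j\<in>{..<k}. A l i j = (\<Sum>r<m. w r i * cnj (w r j))" if "l < n" for l
    using that by (intro psd_on_rank_one_decomposition A) auto
  then obtain m :: "nat \<Rightarrow> nat" and w where w:
    "\<And>l i j. l < n \<Longrightarrow> i < k \<Longrightarrow> j < k \<Longrightarrow> A l i j = (\<Sum>r<m l. w l r i * cnj (w l r j))"
    unfolding Ball_def lessThan_iff by metis
  have "\<exists>(M::nat) z. B l = (\<Sum>r<M. outer (z r))" if l: "l < n" for l
  proof -
    obtain M :: nat and z where "\<And>i j. B l $ i $ j = (\<Sum>r<M. z r i * cnj (z r j))"
      using psd_on_rank_one_decomposition[OF finite_class.finite_UNIV B[OF l, unfolded psd_def]] by auto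
    then have "B l = (\<Sum>r<M. outer (\<chi> i. z r i))"
      by (simp add: vec_eq_iff outer_def)
    then show ?thesis
      by (intro exI)
  qed
  then obtain M :: "nat \<Rightarrow> nat" and z where z: "\<And>l. l < n \<Longrightarrow> B l = (\<Sum>r<M l. outer (z l r))"
    by metis
  define u where "u l r = (\<chi> c. cnj (w l r (g c)))" for l r
  have "\<Phi> X = (\<Sum>l<n. \<Sum>s<M l. \<Sum>r<m l. cscale (quad_form (u l r) X) (outer (z l s)))" for X
  proof -
    have X: "X = (\<Sum>c\<in>UNIV. \<Sum>d\<in>UNIV. cscale (X $ c $ d) (E c d))"
    proof -
      have "cscale (X $ c $ d) (E c d) $ i $ j = (if c = i then if d = j then X $ i $ j else 0 else 0)"
        for c d i j
        by (auto simp: cscale_def E_def)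
      moreover have "(\<Sum>d\<in>UNIV. if c = i then if d = j then X $ i $ j else 0 else 0)
          = (if c = i then X $ i $ j else 0)" for c i j
        by simp
      ultimately show ?thesis
        by (simp add: vec_eq_iff)
    qed
    have "\<Phi> X = \<Phi> (\<Sum>c\<in>UNIV. \<Sum>d\<in>UNIV. cscale (X $ c $ d) (E c d))"
      using arg_cong[OF X, of \<Phi>] .
    also have "\<dots> = (\<Sum>c\<in>UNIV. \<Sum>d\<in>UNIV. cscale (X $ c $ d) (\<Phi> (E c d)))"
      by (simp add: lin_sum lin(2))
    also have "\<dots> = (\<Sum>c\<in>UNIV. \<Sum>d\<in>UNIV. \<Sum>l<n. cscale (X $ c $ d * A l (g c) (g d)) (B l))"
      by (simp add: \<Phi>E cscale_sum_right cscale_cscale)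
    also have "\<dots> = (\<Sum>l<n. cscale (\<Sum>c\<in>UNIV. \<Sum>d\<in>UNIV. X $ c $ d * A l (g c) (g d)) (B l))"
      by (simp add: cscale_sum_left sum.swap[of _ "{..<n}"])
    also have "\<dots> = (\<Sum>l<n. cscale (\<Sum>r<m l. quad_form (u l r) X) (B l))"
    proof (intro sum.cong refl arg_cong2[of _ _ _ _ cscale])
      fix l assume "l \<in> {..<n}"
      then have "(\<Sum>c\<in>UNIV. \<Sum>d\<in>UNIV. X $ c $ d * A l (g c) (g d))
          = (\<Sum>c\<in>UNIV. \<Sum>d\<in>UNIV. \<Sum>r<m l. cnj (u l r $ c) * X $ c $ d * u l r $ d)"
        by (simp add: w g u_def sum_distrib_left mult_ac)
      also have "\<dots> = (\<Sum>r<m l. quad_form (u l r) X)"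
        by (simp add: quad_form_eq_sum sum.swap[of _ "{..<m l}"])
      finally show "(\<Sum>c\<in>UNIV. \<Sum>d\<in>UNIV. X $ c $ d * A l (g c) (g d)) = \<dots>" .
    qed
    also have "\<dots> = (\<Sum>l<n. \<Sum>s<M l. \<Sum>r<m l. cscale (quad_form (u l r) X) (outer (z l s)))"
      by (simp add: z cscale_sum_left cscale_sum_right)
    finally show ?thesis .
  qed
  then have "\<Phi> = (\<lambda>X. \<Sum>l<n. \<Sum>s<M l. \<Sum>r<m l. cscale (quad_form (u l r) X) (outer (z l s)))"
    by blast
  then show ?thesis
    by (rule ssubst) (intro holevo_sum holevo_atom)
qed

lemma UEB_iff_holevo: "\<Phi> \<in> UEB \<longleftrightarrow> holevo \<Phi> \<and> \<Phi> (mat 1) = mat 1"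
  using holevo_of_entanglement_breaking entanglement_breaking_of_holevo by (auto simp: UEB_def)

section \<open>Pure states as extreme points\<close>

lemma holevo_orthogonal_projection_nonneg:
  assumes "holevo \<Psi>" "cinner u u = 1"
  shows "0 \<le> quad_form w (\<Psi> (mat 1 - outer u))"
proof -
  obtain n :: nat and v b where \<Psi>: "\<Psi> = (\<lambda>X. \<Sum>l<n. cscale (quad_form (v l) X) (outer (b l)))"
    using assms(1) unfolding holevo_def by blast
  show ?thesis
    unfolding \<Psi> quad_form_sum quad_form_cscale quad_form_orthogonal_projection[OF assms(2)]
    by (intro sum_nonneg mult_nonneg_nonneg cinner_self_nonneg quad_form_outer_nonneg)
qed

text \<open>
  The null condition is a sum of nonnegative products of the squared distance from \<open>v\<^sub>l\<close> to the line
  through \<open>u\<close> and \<open>|\<langle>b\<^sub>l, w\<rangle>|\<^sup>2\<close>.  Taking \<open>w = b\<^sub>l\<close> shows that \<open>b\<^sub>l = 0\<close> or \<open>v\<^sub>l\<close> lies on that line.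
  Hence \<open>\<Psi>\<close> depends on \<open>X\<close> only through \<open>\<langle>u, X u\<rangle>\<close>, and unitality fixes the remaining factor.
\<close>

lemma holevo_eq_pure_state:
  assumes "holevo \<Psi>" "\<Psi> (mat 1) = mat 1" "cinner u u = 1"
    and null: "\<And>w. quad_form w (\<Psi> (mat 1 - outer u)) = 0"
  shows "\<Psi> = (\<lambda>X. cscale (quad_form u X) (mat 1))"
proof
  fix X
  obtain n :: nat and v b where \<Psi>: "\<Psi> = (\<lambda>X. \<Sum>l<n. cscale (quad_form (v l) X) (outer (b l)))"
    using assms(1) unfolding holevo_def by blast
  have "cscale (quad_form (v l) X) (outer (b l))
      = cscale (quad_form u X) (cscale (quad_form (v l) (mat 1)) (outer (b l)))" if l: "l < n" for l
  proof -
    define y where "y = v l - cinner u (v l) *s u"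
    have "(\<Sum>i<n. quad_form (v i) (mat 1 - outer u) * quad_form (b l) (outer (b i))) = 0"
      using null[of "b l"] by (simp add: \<Psi> quad_form_sum quad_form_cscale)
    then have "quad_form (v l) (mat 1 - outer u) * quad_form (b l) (outer (b l)) = 0"
      using l by (subst (asm) sum_nonneg_eq_0_iff)
        (auto simp: quad_form_orthogonal_projection[OF assms(3)] intro!: mult_nonneg_nonneg
          cinner_self_nonneg quad_form_outer_nonneg)
    then have "y = 0 \<or> b l = 0"
      by (auto simp: quad_form_orthogonal_projection[OF assms(3)] quad_form_outer y_def
          cinner_self_eq_0_iff)
    then show ?thesis
    proof
      assume "b l = 0"
      then show ?thesis
        by (simp add: outer_0 cscale_0_right)
    next
      assume "y = 0"
      then have "v l = cinner u (v l) *s u"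
        by (simp add: y_def)
      then obtain c where "v l = c *s u" ..
      then show ?thesis
        using assms(3)
        by (simp add: quad_form_scale quad_form_mat_1 cscale_cscale cinner_scale_left cinner_scale_right mult_ac)
    qed
  qed
  then have "\<Psi> X = cscale (quad_form u X) (\<Psi> (mat 1))"
    unfolding \<Psi> by (simp add: cscale_sum_right)
  then show "\<Psi> X = cscale (quad_form u X) (mat 1)"
    using assms(2) by simp
qed

lemma pure_state_UEB:
  assumes "cinner u u = 1"
  shows "(\<lambda>X. cscale (quad_form u X) (mat 1)) \<in> UEB"
proof -
  have "holevo (\<lambda>X. cscale (quad_form u X) (mat 1))"
    by (simp add: mat_1_eq_sum_outer cscale_sum_right holevo_sum holevo_atom)
  then show ?thesis
    using assms by (simp add: UEB_iff_holevo quad_form_mat_1 cscale_1)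
qed

text \<open>
  Every \<open>\<Psi>\<^sub>i\<close> of a decomposition coincides with the pure state, so the identity can serve as each of
  the unitaries.
\<close>

lemma cstar_extreme_pure_state:
  fixes u :: "complex^'a::finite"
  assumes u: "cinner u u = 1"
  shows "cstar_extreme (\<lambda>X. cscale (quad_form u X) (mat 1 :: 'b::finite cmat))"
  unfolding cstar_extreme_def
proof (intro conjI allI impI)
  show "(\<lambda>X. cscale (quad_form u X) (mat 1 :: 'b cmat)) \<in> UEB"
    by (rule pure_state_UEB[OF u])
next
  fix n :: nat and T :: "nat \<Rightarrow> 'b cmat" and \<Psi> :: "nat \<Rightarrow> 'a cmat \<Rightarrow> 'b cmat"
  assume asm: "(\<forall>i<n. invertible (T i) \<and> \<Psi> i \<in> UEB) \<and> (\<Sum>i<n. adj (T i) ** T i) = mat 1 \<and>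
    (\<lambda>X. cscale (quad_form u X) (mat 1)) = (\<lambda>X. \<Sum>i<n. Ad (T i) (\<Psi> i X))"
  then have \<Psi>: "holevo (\<Psi> i)" "\<Psi> i (mat 1) = mat 1" if "i < n" for i
    using that by (auto simp: UEB_iff_holevo)
  have "\<Psi> i = (\<lambda>X. cscale (quad_form u X) (mat 1))" if i: "i < n" for i
  proof (rule holevo_eq_pure_state[OF \<Psi>[OF i] u])
    fix w
    \<comment> \<open>Evaluating at \<open>T' w\<close> undoes \<open>T\<^sub>i\<close>, so the null condition reaches every vector \<open>w\<close>.\<close>
    obtain T' where "T i ** T' = mat 1"
      using asm i by (auto simp: invertible_def)
    then have w: "T i *v (T' *v w) = w"
      by (simp add: matrix_vector_mul_assoc)
    have "(\<Sum>j<n. quad_form (T j *v (T' *v w)) (\<Psi> j (mat 1 - outer u)))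
        = quad_form (T' *v w) (\<Sum>j<n. Ad (T j) (\<Psi> j (mat 1 - outer u)))"
      by (simp add: quad_form_sum quad_form_Ad)
    also have "\<dots> = quad_form (T' *v w) (cscale (quad_form u (mat 1 - outer u)) (mat 1))"
      using fun_cong[OF asm[THEN conjunct2, THEN conjunct2], of "mat 1 - outer u"] by simp
    also have "\<dots> = 0"
      by (simp add: quad_form_orthogonal_projection u quad_form_cscale cinner_self_eq_0_iff)
    finally have "quad_form (T i *v (T' *v w)) (\<Psi> i (mat 1 - outer u)) = 0"
      using i \<Psi>(1) u
      by (subst (asm) sum_nonneg_eq_0_iff) (auto simp: holevo_orthogonal_projection_nonneg)
    then show "quad_form w (\<Psi> i (mat 1 - outer u)) = 0"
      by (simp only: w)
  qed
  then show "\<exists>U. \<forall>i<n. unitary_mat (U i) \<and> \<Psi> i = Ad (U i) \<circ> (\<lambda>X. cscale (quad_form u X) (mat 1))"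
    by (intro exI[of _ "\<lambda>_. mat 1"]) (auto simp: unitary_mat_def Ad_def adj_mat_1)
qed

section \<open>The hull of the extreme points\<close>

text \<open>
  The factor is the rank-one matrix with the single nonzero row \<open>c b\<^sup>*\<close>; which row carries it is
  immaterial, so it is placed at the unspecified index \<open>undefined\<close>.
\<close>

lemma outer_eq_adj_mult:
  fixes b :: "complex^'d::finite"
  shows "\<exists>T. adj T ** T = cscale (cnj c * c) (outer b)"
proof
  define T :: "'d cmat" where "T = (\<chi> i j. if i = undefined then c * cnj (b $ j) else 0)"
  have "(adj T ** T) $ i $ j = (\<Sum>k\<in>(UNIV :: 'd set). if k = undefined then cnj c * c * (b $ i * cnj (b $ j)) else 0)" for i j
    unfolding matrix_matrix_mult_def adj_def transpose_def T_def nth_map_matrix vec_lambda_beta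
    by (intro sum.cong refl) auto
  then show "adj T ** T = cscale (cnj c * c) (outer b)"
    by (simp add: vec_eq_iff cscale_def outer_def)
qed

lemma cstar_convex_hull_subset_UEB:
  assumes "S \<subseteq> UEB"
  shows "cstar_convex_hull S \<subseteq> UEB"
proof
  fix \<Phi> assume "\<Phi> \<in> cstar_convex_hull S"
  then obtain n :: nat and T \<Psi> where \<Psi>: "\<And>i. i < n \<Longrightarrow> \<Psi> i \<in> UEB"
    and T: "(\<Sum>i<n. adj (T i) ** T i) = mat 1" and \<Phi>: "\<Phi> = (\<lambda>X. \<Sum>i<n. Ad (T i) (\<Psi> i X))"
    using assms unfolding cstar_convex_hull_def by blast
  have "holevo \<Phi>"
    using \<Psi> unfolding \<Phi> by (auto simp: UEB_iff_holevo intro!: holevo_sum holevo_Ad)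
  moreover have "\<Phi> (mat 1) = mat 1"
    using \<Psi> T by (simp add: \<Phi> UEB_iff_holevo Ad_mat_1)
  ultimately show "\<Phi> \<in> UEB"
    by (simp add: UEB_iff_holevo)
qed

theorem theorem5p11:
  shows "(UEB :: (complex^'d1::finite^'d1 \<Rightarrow> complex^'d2::finite^'d2) set) =
           cstar_convex_hull {\<Phi>. cstar_extreme \<Phi>}"
proof
  show "cstar_convex_hull {\<Phi> :: 'd1 cmat \<Rightarrow> 'd2 cmat. cstar_extreme \<Phi>} \<subseteq> UEB"
    by (intro cstar_convex_hull_subset_UEB) (auto simp: cstar_extreme_def)
next
  show "(UEB :: ('d1 cmat \<Rightarrow> 'd2 cmat) set) \<subseteq> cstar_convex_hull {\<Phi>. cstar_extreme \<Phi>}"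
  proof
    fix \<Phi> :: "'d1 cmat \<Rightarrow> 'd2 cmat" assume UEB: "\<Phi> \<in> UEB"
    then obtain n :: nat and v b where \<Phi>: "\<Phi> = (\<lambda>X. \<Sum>l<n. cscale (quad_form (v l) X) (outer (b l)))"
      unfolding UEB_iff_holevo holevo_def by blast
    have "\<exists>c u. cinner u u = 1 \<and> v l = c *s u" for l
      by (metis obtain_unit_multiple)
    then obtain c u where u: "\<And>l. cinner (u l) (u l) = 1" and v: "\<And>l. v l = c l *s u l"
      by metis
    have "\<exists>T. adj T ** T = cscale (cnj (c l) * c l) (outer (b l))" for l
      by (rule outer_eq_adj_mult)
    then obtain T where T: "\<And>l. adj (T l) ** T l = cscale (cnj (c l) * c l) (outer (b l))"
      by metis
    define \<Psi> where "\<Psi> l = (\<lambda>X. cscale (quad_form (u l) X) (mat 1 :: 'd2 cmat))" for l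
    have \<Phi>': "\<Phi> = (\<lambda>X. \<Sum>l<n. Ad (T l) (\<Psi> l X))"
      by (simp add: \<Phi> \<Psi>_def v Ad_cscale Ad_mat_1 T cscale_cscale quad_form_scale mult_ac)
    moreover have "(\<Sum>l<n. adj (T l) ** T l) = mat 1"
      using UEB u by (simp add: UEB_iff_holevo \<Phi>' \<Psi>_def quad_form_mat_1 cscale_1 Ad_mat_1)
    moreover have "cstar_extreme (\<Psi> l)" for l
      unfolding \<Psi>_def by (rule cstar_extreme_pure_state[OF u])
    ultimately show "\<Phi> \<in> cstar_convex_hull {\<Phi>. cstar_extreme \<Phi>}"
      unfolding cstar_convex_hull_def
      by (intro CollectI exI[of _ n] exI[of _ T] exI[of _ \<Psi>] conjI) simp_all
  qed
qed

end
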